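(* Let $D\ge 1$, $L>0$, let $d=d_1>\cdots>d_D>0$, and let $(\boldsymbol{x}_1,y_1),\ldots,(\boldsymbol{x}_T,y_T)\in\mathcal{X}\times[0,1]$ be an arbitrary sequence, fixed in advance. Suppose the Locally Adaptive Online Learning algorithm (Hedge style, with the subroutine propagate, both described in the context) is run for $T$ rounds with square loss $\ell_t(y)=\frac12(y_t-y)^2$, with Follow-the-Leader as local learner at each node, and with radius tuning function $$\rho(k,t)=(L\,t)^{-\frac{1}{1+d_k}},$$ and let $\mathcal{T}$ be the resulting hierarchical net (tree). Then for all prunings $E\in\mathcal{E}_{\mathrm{dim}}(\mathcal{T})$ the regret $R_T(f)=\sum_{t=1}^T\big(\ell_t(\widehat y_t)-\ell_t(f(\boldsymbol{x}_t))\big)$ satisfies $$R_T(f)=\widetilde{\mathcal{O}}\left(\mathbb{E}\Big[(L\,T)^{\frac{d_K}{1+d_K}}\Big]+\sum_{k=1}^D\big(L\,T_{E,k}\big)^{\frac{d_k}{1+d_k}}\right)\qquad\text{for all } f\in\mathcal{F}_L,$$ where the expectation is with respect to the random variable $K$ with $\mathbb{P}(K=k)=|E_k|/|E|$, i.e. the fraction of leaves of $E$ that are at level $k$.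
   Context: Setting. $\mathcal{X}\subset\mathbb{R}^d$ is the closed unit ball of a fixed but arbitrary norm $\|\cdot\|$; $\mathcal{B}(\boldsymbol{z},r)$ is the ball of center $\boldsymbol{z}$ and radius $r$. In each round $t=1,2,\ldots$ the learner sees $\boldsymbol{x}_t$, predicts $\widehat y_t\in[0,1]$, then observes $y_t$ and incurs loss $\ell_t(\widehat y_t)$. $\mathcal{F}_L$ is the class of functions $f:\mathcal{X}\to[0,1]$ with $|f(\boldsymbol{x})-f(\boldsymbol{x}')|\le L\|\boldsymbol{x}-\boldsymbol{x}'\|$ for all $\boldsymbol{x},\boldsymbol{x}'\in\mathcal{X}$. Subroutine propagate. The algorithm keeps sets of centers $S_1,\ldots,S_D\subseteq\{1,2,\ldots\}$ (initially empty), where $s\in S_k$ denotes a level-$k$ node centered at $\boldsymbol{x}_s$ and hosting its own local learner (a separate one for each level). In round $t$ set $\mathcal{B}_{\rm parent}=\mathcal{X}$ and for $k=1,\ldots,D$ do: if $S_k=\varnothing$, set $S_k=\{t\}$ and create a learner at $\boldsymbol{x}_t$; let $\varepsilon=\rho(k,t)$ and let $s$ minimize $\|\boldsymbol{x}_i-\boldsymbol{x}_t\|$ over $i\in S_k$ with $\boldsymbol{x}_i\in\mathcal{B}_{\rm parent}$; if $\|\boldsymbol{x}_t-\boldsymbol{x}_s\|\le\varepsilon$ set $\pi_k=s$; otherwise (or if there is no such center) add $t$ to $S_k$, create a learner at $\boldsymbol{x}_t$, and set $\pi_k=t$; finally set $\mathcal{B}_{\rm parent}=\mathcal{B}(\boldsymbol{x}_{\pi_k},\varepsilon)$.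 The nodes $\boldsymbol{\pi}_t=(\pi_1,\ldots,\pi_D)$ (one per level) are the active nodes of round $t$. Hedge-style aggregation. Every node $v$ has weight $1$ when created. In round $t$, with $\widehat y_{v,t}$ the prediction of the local learner at active node $v$ and all sums over the active nodes, predict $\widehat y_t=\frac1{W_{t-1}}\sum_v w_{v,t-1}\widehat y_{v,t}$ with $W_{t-1}=\sum_v w_{v,t-1}$. After observing $y_t$, update the local learners at active nodes with $(\boldsymbol{x}_t,y_t)$, and for each active $v$ set $w_{v,t}=w_{v,t-1}e^{-\frac12\ell_t(\widehat y_{v,t})}/Z_{t-1}$ with $Z_{t-1}=\frac1{W_{t-1}}\sum_v w_{v,t-1}e^{-\frac12\ell_t(\widehat y_{v,t})}$. Inactive nodes are unchanged. Follow-the-Leader at a node predicts a minimizer over $y\in[0,1]$ of the sum of $\ell_s(y)$ over the past rounds $s$ in which the node was active (arbitrary value in $[0,1]$ if there are none). Tree and prunings. After $T$ rounds, $\mathcal{T}$ is the rooted tree whose root is $\mathcal{X}$ (level $0$, no learner) and whose level-$k$ nodes are the elements of $S_k$; the parent of a node is the node preceding it on the path $\boldsymbol{\pi}_t$ of the round $t$ in which it was created. Each $\boldsymbol{\pi}_t$ is regarded as a root-to-leaf path. A pruning $E$ of $\mathcal{T}$ is obtained by zero or more operations, each deleting the subtree below an internal node while keeping that node (which becomes a leaf). $E_k=\mathrm{leaves}_k(\mathcal{T},E)\subseteq S_k$ is the set of leaves of $E$ at level $k$, and $|E|=|E_1|+\cdots+|E_D|$ (the leaves considered are at levels $1,\ldots,D$).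 Each round $t$ is associated with the unique leaf of $E$ lying on $\boldsymbol{\pi}_t$; $T_{E,k}$ is the number of rounds $t\le T$ whose associated leaf is at level $k$. Admissible prunings. $\mathcal{E}_{\mathrm{dim}}(\mathcal{T})$ is the set of prunings $E$ of $\mathcal{T}$ such that $|\mathrm{leaves}_k(\mathcal{T},E)|\le C\,(L\,T)^{\frac{d_k}{1+d_k}}$ for $k=1,\ldots,D$, where $C>0$ is the constant in the metric dimension of $\mathcal{X}$: for every $\varepsilon\in(0,1]$, $\mathcal{X}$ has an $\varepsilon$-cover of size at most $C\varepsilon^{-d}$. Notation $\widetilde{\mathcal{O}}$: an upper bound up to a multiplicative constant and factors polylogarithmic in $T$, for all $T\ge T_0$. The constants may depend on $d_1,\ldots,d_D$, $D$, $C$ and the norm, and $T_0$ also on $L$, but they do not depend on the data sequence, $E$ or $f$.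
   Formalization: The bound is stated for prunings E such that every round's active nodes contain exactly one leaf of E; propagate as described does not guarantee this (a reused node may have a different parent), and without it T_{E,k} is undefined. *)

theory Defs
  imports "HOL-Probability.Probability"
begin

section \<open>Geometry of the instance space\<close>

definition is_norm :: "('a::real_vector \<Rightarrow> real) \<Rightarrow> bool" where
  "is_norm N \<longleftrightarrow>
     (\<forall>x. N x = 0 \<longleftrightarrow> x = 0) \<and>
     (\<forall>a x. N (a *\<^sub>R x) = \<bar>a\<bar> * N x) \<and>
     (\<forall>x y. N (x + y) \<le> N x + N y)"

definition nball :: "('a::real_vector \<Rightarrow> real) \<Rightarrow> 'a \<Rightarrow> real \<Rightarrow> 'a set" where
  "nball N z r = {x. N (x - z) \<le> r}"

abbreviation unit_nball :: "('a::real_vector \<Rightarrow> real) \<Rightarrow> 'a set" where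
  "unit_nball N \<equiv> nball N 0 1"

definition is_cover :: "('a::real_vector \<Rightarrow> real) \<Rightarrow> real \<Rightarrow> 'a set \<Rightarrow> 'a set \<Rightarrow> bool" where
  "is_cover N \<epsilon> X G \<longleftrightarrow> finite G \<and> G \<subseteq> X \<and> X \<subseteq> (\<Union>g\<in>G. nball N g \<epsilon>)"

text \<open>\<open>X\<close> has metric dimension \<open>d\<close>, witnessed by the constant \<open>C\<close>.\<close>

definition metric_dim_const :: "('a::real_vector \<Rightarrow> real) \<Rightarrow> 'a set \<Rightarrow> real \<Rightarrow> real \<Rightarrow> bool" where
  "metric_dim_const N X d C \<longleftrightarrow>
     0 < C \<and>
     (\<forall>\<epsilon>\<in>{0<..1}. \<exists>G. is_cover N \<epsilon> X G \<and> real (card G) \<le> C * \<epsilon> powr (- d))"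

text \<open>Only the values of \<open>f\<close> on the unit ball are constrained (and used).\<close>

definition lip_class :: "('a::real_vector \<Rightarrow> real) \<Rightarrow> real \<Rightarrow> ('a \<Rightarrow> real) set" where
  "lip_class N L =
     {f. (\<forall>x\<in>unit_nball N. f x \<in> {0..1}) \<and>
         (\<forall>x\<in>unit_nball N. \<forall>x'\<in>unit_nball N. \<bar>f x - f x'\<bar> \<le> L * N (x - x'))}"

section \<open>The online algorithm\<close>

text \<open>
  The algorithm leaves open how ties between nearest centers are broken and what Follow-the-Leader
  predicts when it has seen no data. Hence it is specified relationally: the predicates below say
  that given sequences describe a possible execution during rounds \<open>1, \<dots>, T\<close>.

  \<^item> \<open>S t k\<close> is the set of level-\<open>k\<close> centers at the end of round \<open>t\<close>;
  \<^item> \<open>p t k\<close> is the level-\<open>k\<close> node on the path of active nodes of round \<open>t\<close>;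
  \<^item> a node is a pair \<open>(k, s)\<close> of its level and the round in which it was created, so that the same
    round can create distinct nodes on several levels;
  \<^item> \<open>w v t\<close> is the weight of node \<open>v\<close> at the end of round \<open>t\<close>, \<open>g v t\<close> the prediction of its local
    learner in round \<open>t\<close>, and \<open>yh t\<close> the prediction of the algorithm.
\<close>

type_synonym node = "nat \<times> nat"

definition propagate_level ::
  "('a::real_vector \<Rightarrow> real) \<Rightarrow> (nat \<Rightarrow> 'a) \<Rightarrow> nat \<Rightarrow> real \<Rightarrow> 'a set \<Rightarrow> nat set \<Rightarrow> nat set \<Rightarrow> nat \<Rightarrow> bool"
where
  "propagate_level N x t \<epsilon> Bparent Sold Snew s' \<longleftrightarrow>
     (let S0 = (if Sold = {} then {t} else Sold);
          cand = {i \<in> S0. x i \<in> Bparent}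
      in if cand = {} then s' = t \<and> Snew = insert t S0
         else \<exists>s. is_arg_min (\<lambda>i. N (x i - x t)) (\<lambda>i. i \<in> cand) s \<and>
                  (if N (x t - x s) \<le> \<epsilon> then s' = s \<and> Snew = S0
                   else s' = t \<and> Snew = insert t S0))"

definition parent_ball ::
  "('a::real_vector \<Rightarrow> real) \<Rightarrow> (nat \<Rightarrow> nat \<Rightarrow> real) \<Rightarrow> (nat \<Rightarrow> 'a) \<Rightarrow> (nat \<Rightarrow> nat \<Rightarrow> nat) \<Rightarrow> nat \<Rightarrow> nat \<Rightarrow> 'a set"
where
  "parent_ball N \<rho> x p t k =
     (if k = 1 then unit_nball N else nball N (x (p t (k - 1))) (\<rho> (k - 1) t))"

definition propagate_run ::
  "('a::real_vector \<Rightarrow> real) \<Rightarrow> nat \<Rightarrow> (nat \<Rightarrow> nat \<Rightarrow> real) \<Rightarrow> nat \<Rightarrow> (nat \<Rightarrow> 'a) \<Rightarrow>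
   (nat \<Rightarrow> nat \<Rightarrow> nat set) \<Rightarrow> (nat \<Rightarrow> nat \<Rightarrow> nat) \<Rightarrow> bool"
where
  "propagate_run N D \<rho> T x S p \<longleftrightarrow>
     (\<forall>k\<in>{1..D}. S 0 k = {}) \<and>
     (\<forall>t\<in>{1..T}. \<forall>k\<in>{1..D}.
        propagate_level N x t (\<rho> k t) (parent_ball N \<rho> x p t k) (S (t - 1) k) (S t k) (p t k))"

definition active_nodes :: "nat \<Rightarrow> (nat \<Rightarrow> nat \<Rightarrow> nat) \<Rightarrow> nat \<Rightarrow> node set" where
  "active_nodes D p t = {(k, p t k) |k. k \<in> {1..D}}"

definition hedge_run ::
  "nat \<Rightarrow> nat \<Rightarrow> (nat \<Rightarrow> real \<Rightarrow> real) \<Rightarrow> (nat \<Rightarrow> nat \<Rightarrow> nat set) \<Rightarrow> (nat \<Rightarrow> nat \<Rightarrow> nat) \<Rightarrow>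
   (node \<Rightarrow> nat \<Rightarrow> real) \<Rightarrow> (node \<Rightarrow> nat \<Rightarrow> real) \<Rightarrow> (nat \<Rightarrow> real) \<Rightarrow> bool"
where
  "hedge_run D T loss S p w g yh \<longleftrightarrow>
     (\<forall>t\<in>{1..T}.
        (\<forall>k\<in>{1..D}. \<forall>s \<in> S t k - S (t - 1) k. w (k, s) (t - 1) = 1) \<and>
        (let A = active_nodes D p t;
             W = (\<Sum>v\<in>A. w v (t - 1));
             Z = (\<Sum>v\<in>A. w v (t - 1) * exp (- (1/2) * loss t (g v t))) / W
         in yh t = (\<Sum>v\<in>A. w v (t - 1) * g v t) / W \<and>
            (\<forall>v\<in>A. w v t = w v (t - 1) * exp (- (1/2) * loss t (g v t)) / Z) \<and>
            (\<forall>k\<in>{1..D}. \<forall>s \<in> S t k. (k, s) \<notin> A \<longrightarrow> w (k, s) t = w (k, s) (t - 1))))"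

text \<open>For a node without past rounds the sum is empty and every point of the unit interval is
  a minimizer, i.e. the prediction is arbitrary.\<close>

definition ftl_run ::
  "nat \<Rightarrow> nat \<Rightarrow> (nat \<Rightarrow> real \<Rightarrow> real) \<Rightarrow> (nat \<Rightarrow> nat \<Rightarrow> nat) \<Rightarrow> (node \<Rightarrow> nat \<Rightarrow> real) \<Rightarrow> bool"
where
  "ftl_run D T loss p g \<longleftrightarrow>
     (\<forall>t\<in>{1..T}. \<forall>v\<in>active_nodes D p t.
        is_arg_min (\<lambda>y. \<Sum>s\<in>{s\<in>{1..<t}. v \<in> active_nodes D p s}. loss s y) (\<lambda>y. y \<in> {0..1}) (g v t))"

definition sq_loss :: "(nat \<Rightarrow> real) \<Rightarrow> nat \<Rightarrow> real \<Rightarrow> real" where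
  "sq_loss y t z = (1/2) * (y t - z)\<^sup>2"

definition regret ::
  "nat \<Rightarrow> (nat \<Rightarrow> real \<Rightarrow> real) \<Rightarrow> (nat \<Rightarrow> real) \<Rightarrow> (nat \<Rightarrow> 'a) \<Rightarrow> ('a \<Rightarrow> real) \<Rightarrow> real"
where
  "regret T loss yh x f = (\<Sum>t\<in>{1..T}. loss t (yh t) - loss t (f (x t)))"

section \<open>The hierarchical net and its prunings\<close>

definition net_root :: node where "net_root = (0, 0)"

definition net_nodes :: "nat \<Rightarrow> nat \<Rightarrow> (nat \<Rightarrow> nat \<Rightarrow> nat set) \<Rightarrow> node set" where
  "net_nodes D T S = insert net_root {(k, s) |k s. k \<in> {1..D} \<and> s \<in> S T k}"

text \<open>The node \<open>(k, s)\<close> was created in round \<open>s\<close>, hence its parent is found on the path of round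
  \<open>s\<close>.\<close>

definition parent_node :: "(nat \<Rightarrow> nat \<Rightarrow> nat) \<Rightarrow> node \<Rightarrow> node" where
  "parent_node p v = (case v of (k, s) \<Rightarrow> if k = 1 then net_root else (k - 1, p s (k - 1)))"

definition net_edges :: "nat \<Rightarrow> nat \<Rightarrow> (nat \<Rightarrow> nat \<Rightarrow> nat set) \<Rightarrow> (nat \<Rightarrow> nat \<Rightarrow> nat) \<Rightarrow> node rel" where
  "net_edges D T S p = {(parent_node p v, v) |v. v \<in> net_nodes D T S - {net_root}}"

text \<open>A tree is given by its node set \<open>V\<close> and its parent-to-child relation \<open>R\<close>; a pruning is
  represented by the set of nodes that are kept.\<close>

inductive is_pruning :: "'v set \<Rightarrow> 'v rel \<Rightarrow> 'v set \<Rightarrow> bool" for V R where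
  full: "is_pruning V R V"
| cut: "is_pruning V R (E - {u. (v, u) \<in> R\<^sup>+})"
    if "is_pruning V R E" "v \<in> E" "\<exists>u\<in>E. (v, u) \<in> R"

definition leaves :: "'v rel \<Rightarrow> 'v set \<Rightarrow> 'v set" where
  "leaves R E = {v\<in>E. \<forall>u\<in>E. (v, u) \<notin> R}"

definition leaves_at :: "node rel \<Rightarrow> node set \<Rightarrow> nat \<Rightarrow> node set" where
  "leaves_at R E k = {v\<in>leaves R E. fst v = k}"

definition num_leaves :: "nat \<Rightarrow> node rel \<Rightarrow> node set \<Rightarrow> nat" where
  "num_leaves D R E = (\<Sum>k\<in>{1..D}. card (leaves_at R E k))"

text \<open>Because of overlapping balls and shrinking radii, \<open>propagate\<close> alone does not force the active
  nodes of a round to form a path of the net. Whenever they do, the following property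
  holds for all prunings except the one that keeps only the root, which has no leaves on levels
  \<open>1, \<dots>, D\<close>; see \<open>unique_leaf_on_paths_if_root_paths\<close> below. The leaf associated with a round
  is only meaningful under this property.\<close>

definition unique_leaf_on_paths ::
  "nat \<Rightarrow> nat \<Rightarrow> (nat \<Rightarrow> nat \<Rightarrow> nat) \<Rightarrow> node rel \<Rightarrow> node set \<Rightarrow> bool" where
  "unique_leaf_on_paths D T p R E \<longleftrightarrow>
     (\<forall>t\<in>{1..T}. \<exists>!v. v \<in> leaves R E \<and> v \<in> active_nodes D p t)"

definition leaf_of_round ::
  "nat \<Rightarrow> (nat \<Rightarrow> nat \<Rightarrow> nat) \<Rightarrow> node rel \<Rightarrow> node set \<Rightarrow> nat \<Rightarrow> node" where
  "leaf_of_round D p R E t = (THE v. v \<in> leaves R E \<and> v \<in> active_nodes D p t)"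

definition rounds_at ::
  "nat \<Rightarrow> nat \<Rightarrow> (nat \<Rightarrow> nat \<Rightarrow> nat) \<Rightarrow> node rel \<Rightarrow> node set \<Rightarrow> nat \<Rightarrow> nat" where
  "rounds_at D T p R E k = card {t\<in>{1..T}. fst (leaf_of_round D p R E t) = k}"

definition dim_prunings ::
  "nat \<Rightarrow> nat \<Rightarrow> real \<Rightarrow> real \<Rightarrow> (nat \<Rightarrow> real) \<Rightarrow> node set \<Rightarrow> node rel \<Rightarrow> node set set" where
  "dim_prunings D T L C d V R =
     {E. is_pruning V R E \<and>
         (\<forall>k\<in>{1..D}. real (card (leaves_at R E k)) \<le> C * (L * real T) powr (d k / (1 + d k)))}"

definition radius :: "real \<Rightarrow> (nat \<Rightarrow> real) \<Rightarrow> nat \<Rightarrow> nat \<Rightarrow> real" where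
  "radius L d k t = (L * real t) powr (- (1 / (1 + d k)))"

section \<open>Rounds whose active nodes form root-to-leaf paths\<close>

lemma net_edges_level:
  assumes "(v, u) \<in> net_edges D T S p"
  shows "u \<in> net_nodes D T S" "fst u = Suc (fst v)" "v = parent_node p u"
  using assms by (auto simp: net_edges_def net_nodes_def parent_node_def net_root_def split: if_splits)

lemma pruning_closed:
  assumes "is_pruning V R E" "V = net_nodes D T S" "R = net_edges D T S p"
    and cl: "\<And>u v. (v, u) \<in> R \<Longrightarrow> v \<in> V"
  shows "E \<subseteq> V \<and> (\<forall>v u. (v, u) \<in> R \<longrightarrow> u \<in> E \<longrightarrow> v \<in> E) \<and>
     (\<forall>v\<in>E. (\<forall>u. (v, u) \<in> R \<longrightarrow> u \<in> E) \<or> (\<forall>u. (v, u) \<in> R \<longrightarrow> u \<notin> E)) \<and> net_root \<in> E"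
  using assms(1)
proof (induction rule: is_pruning.induct)
  case full
  then show ?case using assms net_edges_level(1) cl by (auto simp: net_nodes_def)
next
  case (cut E v)
  let ?D = "{u. (v, u) \<in> R\<^sup>+}"
  have uniq: "a = b" if "(a, u) \<in> R" "(b, u) \<in> R" for a b u
    using that net_edges_level(3) unfolding assms by metis
  have down: "u \<in> ?D" if "a \<in> ?D" "(a, u) \<in> R" for a u using that by auto
  have up: "a = v \<or> a \<in> ?D" if "u \<in> ?D" "(a, u) \<in> R" for a u
  proof -
    from that(1) have "(v, u) \<in> R\<^sup>+" by simp
    then show ?thesis
    proof (cases rule: tranclE)
      case base
      then show ?thesis using uniq[OF that(2)] by simp
    next
      case (step c)
      then show ?thesis using uniq[OF that(2) step(2)] by simp
    qed
  qed
  have nr: "net_root \<notin> ?D"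
  proof
    assume "net_root \<in> ?D"
    then have "(v, net_root) \<in> R\<^sup>+" by simp
    then obtain a where "(a, net_root) \<in> R" by (cases rule: trancl.cases) auto
    then show False using net_edges_level(2) unfolding assms net_root_def by fastforce
  qed
  have "(\<forall>u. (a, u) \<in> R \<longrightarrow> u \<in> E - ?D) \<or> (\<forall>u. (a, u) \<in> R \<longrightarrow> u \<notin> E - ?D)" if a: "a \<in> E - ?D" for a
  proof (cases "a = v")
    case True then show ?thesis by auto
  next
    case False
    then have "u \<notin> ?D" if "(a, u) \<in> R" for u using up[OF _ that] a by auto
    then show ?thesis using cut.IH a by blast
  qed
  moreover have "\<forall>a u. (a, u) \<in> R \<longrightarrow> u \<in> E - ?D \<longrightarrow> a \<in> E - ?D"
    using cut.IH down by blast
  moreover have "E - ?D \<subseteq> V" "net_root \<in> E - ?D" using cut.IH nr by auto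
  ultimately show ?case by blast
qed

lemma propagate_run_centers:
  assumes "propagate_run N D \<rho> T x S p" "k \<in> {1..D}"
  shows "t \<le> T \<Longrightarrow> S t k \<subseteq> {1..t}"
    and "t \<in> {1..T} \<Longrightarrow> p t k \<in> S T k"
proof -
  have sub: "S t k \<subseteq> S (t - 1) k \<union> {t}" and mono: "S (t - 1) k \<subseteq> S t k" and mem: "p t k \<in> S t k" if "t \<in> {1..T}" for t
  proof -
    have "propagate_level N x t (\<rho> k t) (parent_ball N \<rho> x p t k) (S (t - 1) k) (S t k) (p t k)"
      using assms that by (auto simp: propagate_run_def)
    then show "S t k \<subseteq> S (t - 1) k \<union> {t}" "S (t - 1) k \<subseteq> S t k" "p t k \<in> S t k"
      by (auto simp: propagate_level_def Let_def is_arg_min_def split: if_splits)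
  qed
  show "S t k \<subseteq> {1..t}" if "t \<le> T" for t
    using that
  proof (induction t)
    case 0 then show ?case using assms by (auto simp: propagate_run_def)
  next
    case (Suc t) then show ?case using sub[of "Suc t"] by fastforce
  qed
  show "p t k \<in> S T k" if "t \<in> {1..T}" for t
  proof -
    have "S t k \<subseteq> S t' k" if "t \<le> t'" "t' \<le> T" for t'
      using that
    proof (induction t' rule: dec_induct)
      case (step n) then show ?case using mono[of "Suc n"] by auto
    qed simp
    then show ?thesis using mem[OF that] that by auto
  qed
qed

lemma unique_leaf_on_paths_if_root_paths:
  fixes S p D T
  defines "V \<equiv> net_nodes D T S" and "R \<equiv> net_edges D T S p"
  assumes run: "propagate_run N D \<rho> T x S p"
    and paths: "\<And>t k. t \<in> {1..T} \<Longrightarrow> k \<in> {2..D} \<Longrightarrow> p (p t k) (k - 1) = p t (k - 1)"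
    and E: "is_pruning V R E" "E \<noteq> {net_root}"
  shows "unique_leaf_on_paths D T p R E"
  unfolding unique_leaf_on_paths_def
proof
  fix t assume t: "t \<in> {1..T}"
  have cl: "v \<in> V" if "(v, u) \<in> R" for v u
  proof -
    obtain k s where u: "u = (k, s)" by (cases u)
    have ks: "k \<in> {1..D}" "s \<in> S T k" and v: "v = parent_node p u"
      using that net_edges_level(3)[OF that[unfolded R_def]]
      by (auto simp: R_def net_edges_def net_nodes_def u)
    have "s \<in> {1..T}" using propagate_run_centers(1)[OF run ks(1), of T] ks(2) by auto
    then have "k \<noteq> 1 \<Longrightarrow> p s (k - 1) \<in> S T (k - 1)"
      using propagate_run_centers(2)[OF run, of "k - 1" s] ks(1) by fastforce
    then show ?thesis using ks(1) by (auto simp: v u parent_node_def V_def net_nodes_def)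
  qed
  have P: "E \<subseteq> V \<and> (\<forall>v u. (v, u) \<in> R \<longrightarrow> u \<in> E \<longrightarrow> v \<in> E) \<and>
     (\<forall>v\<in>E. (\<forall>u. (v, u) \<in> R \<longrightarrow> u \<in> E) \<or> (\<forall>u. (v, u) \<in> R \<longrightarrow> u \<notin> E)) \<and> net_root \<in> E"
    by (rule pruning_closed[OF E(1), of D T S p]) (auto simp: V_def[symmetric] R_def[symmetric] intro: cl)
  have EV: "E \<subseteq> V" and par: "\<And>v u. (v, u) \<in> R \<Longrightarrow> u \<in> E \<Longrightarrow> v \<in> E" and rE: "net_root \<in> E"
    and alt: "\<And>v u u'. v \<in> E \<Longrightarrow> (v, u) \<in> R \<Longrightarrow> (v, u') \<in> R \<Longrightarrow> u \<in> E \<Longrightarrow> u' \<in> E"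
    using P by blast+
  define q where "q k = (if k = 0 then net_root else (k, p t k))" for k
  have q_edge: "(q k, q (Suc k)) \<in> R" if "k < D" for k
    using paths[OF t, of "Suc k"] propagate_run_centers(2)[OF run _ t, of "Suc k"] that
    by (auto simp: q_def R_def net_edges_def net_nodes_def parent_node_def net_root_def)
  have below: "q j \<in> E" if "q k \<in> E" "j \<le> k" "k \<le> D" for j k
    using that(2,1,3)
  proof (induction rule: inc_induct)
    case (step n) then show ?case using par q_edge[of n] by simp
  qed simp
  have q1: "1 \<le> D \<and> q 1 \<in> E"
  proof -
    obtain v where v: "v \<in> E" "v \<noteq> net_root" using E(2) rE by auto
    have "\<exists>u\<in>E. fst u = 1 \<and> u \<in> V" if "fst v = n" "v \<in> E" "v \<noteq> net_root" for n v
      using that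
    proof (induction n arbitrary: v)
      case 0
      then show ?case using EV by (auto simp: V_def net_nodes_def)
    next
      case (Suc n)
      show ?case
      proof (cases "n = 0")
        case True then show ?thesis using Suc EV by auto
      next
        case False
        have e: "(parent_node p v, v) \<in> R" using Suc.prems EV unfolding R_def V_def net_edges_def by blast
        have n: "fst (parent_node p v) = n"
          using net_edges_level(2)[OF e[unfolded R_def]] Suc.prems by simp
        have "parent_node p v \<noteq> net_root"
        proof
          assume "parent_node p v = net_root"
          then show False using n False by (simp add: net_root_def)
        qed
        then show ?thesis using Suc.IH[OF n] par[OF e] Suc.prems by simp
      qed
    qed
    then obtain u where u: "u \<in> E" "fst u = 1" "u \<in> V" using v by blast
    have "(net_root, u) \<in> R" "1 \<le> D" using u
      by (auto simp: R_def V_def net_edges_def net_nodes_def parent_node_def net_root_def)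
    moreover have "(net_root, q 1) \<in> R" using q_edge[of 0] calculation by (simp add: q_def)
    ultimately show ?thesis using alt rE u by blast
  qed
  define m where "m = Max {k\<in>{1..D}. q k \<in> E}"
  have m: "m \<in> {k\<in>{1..D}. q k \<in> E}" unfolding m_def by (rule Max_in) (use q1 in auto)
  have mmax: "k \<le> m" if "k \<in> {1..D}" "q k \<in> E" for k unfolding m_def by (rule Max_ge) (use that in auto)
  have leaf: "q m \<in> leaves R E"
  proof -
    have "False" if u: "u \<in> E" "(q m, u) \<in> R" for u
    proof (cases "m < D")
      case True
      then have "q (Suc m) \<in> E" using alt[OF _ u(2) q_edge[OF True] u(1)] m by auto
      then show False using mmax[of "Suc m"] True by simp
    next
      case False
      have "fst u = Suc m" "u \<in> V" using net_edges_level[OF u(2)[unfolded R_def]] m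
        by (auto simp: q_def V_def split: if_splits)
      then show False using False m by (auto simp: V_def net_nodes_def net_root_def)
    qed
    then show ?thesis using m by (auto simp: leaves_def)
  qed
  have notleaf: "q j \<notin> leaves R E" if "j < m" for j
  proof -
    have "q (Suc j) \<in> E" using below[of m "Suc j"] m that by auto
    then show ?thesis using q_edge[of j] m that by (auto simp: leaves_def)
  qed
  have act: "v \<in> active_nodes D p t \<longleftrightarrow> (\<exists>k\<in>{1..D}. v = q k)" for v
    by (auto simp: active_nodes_def q_def)
  show "\<exists>!v. v \<in> leaves R E \<and> v \<in> active_nodes D p t"
  proof (rule ex1I[of _ "q m"])
    show "q m \<in> leaves R E \<and> q m \<in> active_nodes D p t" using leaf m act by auto
  next
    fix v assume v: "v \<in> leaves R E \<and> v \<in> active_nodes D p t"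
    then obtain k where k: "k \<in> {1..D}" "v = q k" using act by auto
    have "k \<le> m" using v k mmax by (auto simp: leaves_def)
    moreover have "\<not> k < m" using notleaf v k by auto
    ultimately show "v = q m" using k by simp
  qed
qed

end

theory Submission
  imports Defs
begin

text \<open>
  Split the regret into three parts. Square loss on the unit interval is exp-concave, so the excess
  loss of the forecaster over an active node is at most twice the increase of the logarithmic weight
  of that node; as updates preserve the total weight, which is at most \<open>D * T\<close>, each leaf
  contributes at most \<open>2 * ln (D * T)\<close>. Follow-the-Leader has logarithmic regret against the constant
  \<open>f (x s)\<close> at a node centered at \<open>x s\<close>. Finally, replacing \<open>f (x t)\<close> by \<open>f (x s)\<close> costs at most
  \<open>L * \<rho> k t\<close>, and these errors sum to a power of the number of rounds at level \<open>k\<close>. For an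
  admissible pruning, Cauchy-Schwarz bounds the number of leaves by a multiple of the expectation.
\<close>

section \<open>Sums of powers and harmonic numbers\<close>

text \<open>Discrete counterpart of integrating \<open>b * t powr (b - 1)\<close>, shaped for
  telescoping. With \<open>s = n + 1\<close>, Young's inequality for \<open>n / s\<close> and
  \<open>1\<close> with weights \<open>b\<close> and \<open>1 - b\<close> gives
  \<open>(n / s) powr b \<le> 1 - b / s\<close>; multiply by \<open>s powr b\<close>.\<close>

lemma powr_pred_le_diff:
  fixes b :: real
  assumes "0 < b" "b < 1"
  shows "b * real (Suc n) powr (b - 1) \<le> real (Suc n) powr b - real n powr b"
proof (cases "n = 0")
  case True
  then show ?thesis using assms by simp
next
  case False
  define s where "s = real (Suc n)"
  have s: "s > 0" "real n = s - 1" "real n > 0" using False by (auto simp: s_def)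
  have "(real n / s) powr b * 1 powr (1 - b) \<le> b * (real n / s) + (1 - b) * 1"
    using Youngs_inequality_0[of b "1 - b" "real n / s" 1] assms s by simp
  also have "\<dots> = 1 - b / s" using s(1) by (simp add: s(2) field_simps)
  finally have "(real n / s) powr b * s powr b \<le> (1 - b / s) * s powr b"
    by (intro mult_right_mono) auto
  moreover have "(real n / s) powr b * s powr b = real n powr b"
    using s by (simp add: powr_divide)
  moreover have "s powr (b - 1) = s powr b / s"
    using s by (simp add: powr_diff)
  ultimately show ?thesis unfolding s_def[symmetric] by (simp add: algebra_simps)
qed

text \<open>The exponent is negative, so an initial segment is the worst case. In the induction the
  largest element is at least the cardinality of the enlarged set, and the resulting bounds
  telescope.\<close>

lemma sum_powr_le_card_powr:
  fixes b :: real
  assumes "0 < b" "b < 1" "finite B" "B \<subseteq> {1..}"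
  shows "(\<Sum>t\<in>B. real t powr (b - 1)) \<le> real (card B) powr b / b"
  using assms(3,4)
proof (induction B rule: finite_linorder_max_induct)
  case empty
  then show ?case by simp
next
  case (insert t B)
  have "B \<subseteq> {1..<t}" using insert.hyps insert.prems by auto
  then have "card B \<le> card {1..<t}" by (intro card_mono) auto
  moreover have "t \<ge> 1" using insert.prems by auto
  ultimately have t: "Suc (card B) \<le> t" by simp
  have "real t powr (b - 1) \<le> real (Suc (card B)) powr (b - 1)"
    using t assms by (intro powr_mono2') auto
  also have "\<dots> \<le> (real (Suc (card B)) powr b - real (card B) powr b) / b"
    using powr_pred_le_diff[OF assms(1,2), of "card B"] assms(1) by (simp add: field_simps)
  finally have "real t powr (b - 1) + (\<Sum>t\<in>B. real t powr (b - 1)) \<le> real (Suc (card B)) powr b / b"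
    using insert.IH insert.prems by (simp add: diff_divide_distrib)
  moreover have "t \<notin> B" using insert.hyps by auto
  ultimately show ?case using insert.hyps by simp
qed

lemma harm_le_one_plus_ln:
  assumes "n > 0"
  shows "harm n \<le> 1 + ln (real n)"
proof -
  obtain m where m: "n = Suc m" using assms by (cases n) auto
  show ?thesis using decseqD[OF decseq_harm_diff_ln, of 0 m] m by (simp add: harm_Suc harm_def)
qed

section \<open>Follow-the-Leader under square loss\<close>

definition mean :: "(nat \<Rightarrow> real) \<Rightarrow> nat set \<Rightarrow> real" where
  "mean y B = (\<Sum>s\<in>B. y s) / real (card B)"

lemma mean_in_unit:
  assumes "finite B" "B \<noteq> {}" "\<And>s. s \<in> B \<Longrightarrow> y s \<in> {0..1}"
  shows "mean y B \<in> {0..1}"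
proof -
  have "card B > 0" using assms by (simp add: card_gt_0_iff)
  moreover have "0 \<le> sum y B" using assms by (intro sum_nonneg) auto
  moreover have "sum y B \<le> real (card B) * 1" using assms by (intro sum_bounded_above) auto
  ultimately show ?thesis by (simp add: mean_def field_simps)
qed

text \<open>Bias-variance decomposition. It shows both that the mean is optimal and that any other
  minimizer must coincide with it.\<close>

lemma sum_sq_loss_mean:
  assumes "finite B" "B \<noteq> {}"
  shows "(\<Sum>s\<in>B. sq_loss y s z) = (\<Sum>s\<in>B. sq_loss y s (mean y B)) + real (card B) / 2 * (z - mean y B)\<^sup>2"
proof -
  define m where "m = mean y B"
  have c: "card B > 0" using assms by (simp add: card_gt_0_iff)
  have sm: "sum y B = real (card B) * m" using c by (simp add: m_def mean_def)
  have "(\<Sum>s\<in>B. sq_loss y s z) = (\<Sum>s\<in>B. sq_loss y s m + (1/2 * (z\<^sup>2 - m\<^sup>2) - (z - m) * y s))"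
    by (rule sum.cong) (simp_all add: sq_loss_def power2_eq_square algebra_simps)
  also have "\<dots> = (\<Sum>s\<in>B. sq_loss y s m) + (real (card B) * (1/2 * (z\<^sup>2 - m\<^sup>2)) - (z - m) * sum y B)"
    by (simp add: sum.distrib sum_subtractf sum_distrib_left)
  also have "\<dots> = (\<Sum>s\<in>B. sq_loss y s m) + real (card B) / 2 * (z - m)\<^sup>2"
    unfolding sm by (simp add: power2_eq_square algebra_simps)
  finally show ?thesis by (simp add: m_def)
qed

text \<open>The difference factors as \<open>(a - b) * ((a + b) / 2 - y t)\<close>, and the second
  factor lies between -1 and 1.\<close>

lemma sq_loss_diff_le:
  assumes "y t \<in> {0..1}" "a \<in> {0..1}" "b \<in> {0..1}"
  shows "sq_loss y t a - sq_loss y t b \<le> \<bar>a - b\<bar>"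
proof -
  have "sq_loss y t a - sq_loss y t b = (a - b) * ((a + b) / 2 - y t)"
    by (simp add: sq_loss_def power2_eq_square field_simps)
  also have "\<dots> \<le> \<bar>a - b\<bar> * \<bar>(a + b) / 2 - y t\<bar>" by (metis abs_ge_self abs_mult)
  also have "\<dots> \<le> \<bar>a - b\<bar> * 1" using assms by (intro mult_left_mono) (auto simp: abs_le_iff field_simps)
  finally show ?thesis by simp
qed

lemma mean_insert_diff:
  assumes "finite B" "B \<noteq> {}" "t \<notin> B" "\<And>s. s \<in> insert t B \<Longrightarrow> y s \<in> {0..1}"
  shows "\<bar>mean y B - mean y (insert t B)\<bar> \<le> 1 / real (Suc (card B))"
proof -
  have c: "real (card B) > 0" using assms by (simp add: card_gt_0_iff)
  have "mean y B - mean y (insert t B) = (mean y B - y t) / real (Suc (card B))"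
    using assms(1,3) c by (simp add: mean_def divide_simps) (simp add: algebra_simps)
  moreover have "\<bar>mean y B - y t\<bar> \<le> 1"
    using mean_in_unit[of B y] assms by (force simp: abs_le_iff)
  ultimately show ?thesis by (simp add: abs_divide divide_right_mono)
qed

text \<open>Be-the-leader: predicting the mean that includes the current round has no regret, and adding
  the \<open>n\<close>-th round moves the mean by at most \<open>1 / n\<close>.\<close>

lemma ftl_regret_mean:
  assumes "finite B" "\<And>s. s \<in> B \<Longrightarrow> y s \<in> {0..1}" "\<And>t. t \<in> B \<Longrightarrow> g t \<in> {0..1}"
    and "\<And>t. t \<in> B \<Longrightarrow> B \<inter> {..<t} \<noteq> {} \<Longrightarrow> g t = mean y (B \<inter> {..<t})"
  shows "(\<Sum>t\<in>B. sq_loss y t (g t)) \<le> (\<Sum>t\<in>B. sq_loss y t (mean y B)) + harm (card B)"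
  using assms
proof (induction B rule: finite_linorder_max_induct)
  case empty
  then show ?case by (simp add: harm_def)
next
  case (insert b B)
  have eq: "insert b B \<inter> {..<t} = B \<inter> {..<t}" if "t \<in> B" for t using insert.hyps that by auto
  have eqb: "insert b B \<inter> {..<b} = B" using insert.hyps by auto
  have nb: "b \<notin> B" using insert.hyps by auto
  define m' where "m' = mean y (insert b B)"
  have m': "m' \<in> {0..1}" unfolding m'_def using insert by (intro mean_in_unit) auto
  have IH: "(\<Sum>t\<in>B. sq_loss y t (g t)) \<le> (\<Sum>t\<in>B. sq_loss y t (mean y B)) + harm (card B)"
    using insert.IH insert.prems eq by auto
  have "\<bar>g b - m'\<bar> \<le> 1 / real (Suc (card B))"
  \<comment> \<open>In the first round the prediction is arbitrary, but two points of the unit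
    interval differ by at most \<open>1 = 1 / Suc 0\<close>.\<close>
  proof (cases "B = {}")
    case True
    then show ?thesis using m' insert.prems(2)[of b] by auto
  next
    case False
    have "g b = mean y B" using insert.prems(3)[of b] eqb False by simp
    then show ?thesis using mean_insert_diff[OF insert.hyps(1) False nb] insert.prems(1) by (auto simp: m'_def)
  qed
  moreover have "sq_loss y b (g b) - sq_loss y b m' \<le> \<bar>g b - m'\<bar>"
    using insert.prems m' by (intro sq_loss_diff_le) auto
  \<comment> \<open>The old mean is optimal on \<open>B\<close>, so the comparator of the induction
    hypothesis may be replaced by the new mean.\<close>
  moreover have "(\<Sum>t\<in>B. sq_loss y t (mean y B)) \<le> (\<Sum>t\<in>B. sq_loss y t m')"
    using sum_sq_loss_mean[OF insert.hyps(1), of y m'] by (cases "B = {}") auto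
  moreover have "harm (Suc (card B)) = harm (card B) + 1 / real (Suc (card B))"
    by (simp add: harm_Suc inverse_eq_divide)
  ultimately show ?case using IH insert.hyps(1) nb by (simp add: m'_def)
qed

text \<open>The mean of past outcomes lies in the unit interval, so minimality makes the quadratic
  excess of \<open>g t\<close> over it nonpositive and forces equality. Optimality of the overall
  mean then passes from the mean to any constant \<open>u\<close>.\<close>

lemma ftl_regret:
  assumes "finite B" "\<And>s. s \<in> B \<Longrightarrow> y s \<in> {0..1}"
    and ftl: "\<And>t. t \<in> B \<Longrightarrow>
      is_arg_min (\<lambda>z. \<Sum>s\<in>B \<inter> {..<t}. sq_loss y s z) (\<lambda>z. z \<in> {0..1}) (g t)"
  shows "(\<Sum>t\<in>B. sq_loss y t (g t)) \<le> (\<Sum>t\<in>B. sq_loss y t u) + harm (card B)"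
proof -
  have "g t = mean y (B \<inter> {..<t})" if t: "t \<in> B" "B \<inter> {..<t} \<noteq> {}" for t
  proof -
    let ?B = "B \<inter> {..<t}"
    have fin: "finite ?B" using assms(1) by simp
    have "mean y ?B \<in> {0..1}" using assms t by (intro mean_in_unit) auto
    then have "(\<Sum>s\<in>?B. sq_loss y s (g t)) \<le> (\<Sum>s\<in>?B. sq_loss y s (mean y ?B))"
      using ftl[OF t(1)] unfolding is_arg_min_linorder by blast
    then have "real (card ?B) / 2 * (g t - mean y ?B)\<^sup>2 \<le> 0"
      using sum_sq_loss_mean[OF fin t(2), of y "g t"] by simp
    moreover have "real (card ?B) > 0" using fin t(2) by (simp add: card_gt_0_iff)
    ultimately have "(g t - mean y ?B)\<^sup>2 \<le> 0" by (simp only: mult_le_0_iff) linarith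
    then show ?thesis by simp
  qed
  then have "(\<Sum>t\<in>B. sq_loss y t (g t)) \<le> (\<Sum>t\<in>B. sq_loss y t (mean y B)) + harm (card B)"
    using assms by (intro ftl_regret_mean) (auto simp: is_arg_min_linorder)
  moreover have "(\<Sum>t\<in>B. sq_loss y t (mean y B)) \<le> (\<Sum>t\<in>B. sq_loss y t u)"
    using sum_sq_loss_mean[OF assms(1), of y u] by (cases "B = {}") auto
  ultimately show ?thesis by simp
qed

section \<open>Aggregation by exponential weights\<close>

text \<open>The second derivative has the sign of \<open>((y t - z) / 2)\<^sup>2 - 1/2\<close>, and
  the square is at most \<open>1/4\<close> on the unit interval.\<close>

lemma exp_sq_loss_concave:
  assumes "y t \<in> {0..1}"
  shows "concave_on {0..1} (\<lambda>z. exp (- (1/2) * sq_loss y t z))"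
proof (rule f''_le0_imp_concave)
  let ?e = "\<lambda>z. exp (- (1/2) * sq_loss y t z)"
  show "((\<lambda>z. exp (- (1/2) * sq_loss y t z)) has_real_derivative ?e z * ((y t - z) / 2)) (at z)" for z
    unfolding sq_loss_def by (auto intro!: derivative_eq_intros simp: power2_eq_square field_simps)
  show "((\<lambda>z. ?e z * ((y t - z) / 2)) has_real_derivative ?e z * (((y t - z) / 2)\<^sup>2 - 1/2)) (at z)" for z
    unfolding sq_loss_def by (auto intro!: derivative_eq_intros simp: power2_eq_square field_simps)
  show "?e z * (((y t - z) / 2)\<^sup>2 - 1/2) \<le> 0" if "z \<in> {0..1}" for z
  proof -
    have "\<bar>(y t - z) / 2\<bar> \<le> 1/2" using assms that by auto
    then have "((y t - z) / 2)\<^sup>2 \<le> (1/2)\<^sup>2" by (metis abs_ge_zero power2_abs power_mono)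
    then show ?thesis by (intro mult_nonneg_nonpos) (auto simp: power2_eq_square)
  qed
qed auto

text \<open>Jensen's inequality with the normalized weights. The left side becomes the Hedge
  normalizer, the right side the exponentiated loss of the forecaster.\<close>

lemma weighted_exp_sq_loss_le:
  fixes w g :: "'v \<Rightarrow> real"
  assumes "finite A" "A \<noteq> {}" "\<And>v. v \<in> A \<Longrightarrow> w v > 0" "\<And>v. v \<in> A \<Longrightarrow> g v \<in> {0..1}" "y t \<in> {0..1}"
  shows "(\<Sum>v\<in>A. w v * exp (- (1/2) * sq_loss y t (g v))) / sum w A
    \<le> exp (- (1/2) * sq_loss y t ((\<Sum>v\<in>A. w v * g v) / sum w A))"
proof -
  have W: "sum w A > 0" using assms by (intro sum_pos) auto
  have "(\<Sum>v\<in>A. w v / sum w A * exp (- (1/2) * sq_loss y t (g v)))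
      \<le> exp (- (1/2) * sq_loss y t (\<Sum>v\<in>A. (w v / sum w A) *\<^sub>R g v))"
    using assms W
    by (intro concave_on_sum[OF _ _ exp_sq_loss_concave])
      (auto simp: sum_divide_distrib[symmetric] less_imp_le intro!: divide_nonneg_pos)
  then show ?thesis by (simp add: sum_divide_distrib)
qed

section \<open>Runs of the algorithm\<close>

text \<open>The radius function is kept abstract: its concrete form matters only when the
  approximation errors are summed.\<close>

locale algorithm_run =
  fixes N :: "'a::real_vector \<Rightarrow> real" and D T :: nat and \<rho> :: "nat \<Rightarrow> nat \<Rightarrow> real"
    and x :: "nat \<Rightarrow> 'a" and y :: "nat \<Rightarrow> real" and S :: "nat \<Rightarrow> nat \<Rightarrow> nat set"
    and p :: "nat \<Rightarrow> nat \<Rightarrow> nat" and w g :: "node \<Rightarrow> nat \<Rightarrow> real" and yh :: "nat \<Rightarrow> real"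
  assumes norm: "is_norm N"
    and levels: "D \<ge> 1"
    and radius_nonneg: "\<And>k t. \<rho> k t \<ge> 0"
    and x_unit: "\<And>t. t \<in> {1..T} \<Longrightarrow> x t \<in> unit_nball N"
    and y_unit: "\<And>t. t \<in> {1..T} \<Longrightarrow> y t \<in> {0..1}"
    and propagate: "propagate_run N D \<rho> T x S p"
    and hedge: "hedge_run D T (sq_loss y) S p w g yh"
    and ftl: "ftl_run D T (sq_loss y) p g"
begin

section \<open>Nodes created and active over time\<close>

abbreviation active :: "nat \<Rightarrow> node set" where
  "active t \<equiv> active_nodes D p t"

text \<open>The net root is left out, since it carries neither a learner nor a weight.\<close>

definition created :: "nat \<Rightarrow> node set" where
  "created t = (SIGMA k:{1..D}. S t k)"

lemma propagate_step:
  assumes "t \<in> {1..T}" "k \<in> {1..D}"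
  shows "S (t - 1) k \<subseteq> S t k" "S t k \<subseteq> insert t (S (t - 1) k)" "p t k \<in> S t k"
    and "N (x t - x (p t k)) \<le> \<rho> k t"
proof -
  have P: "propagate_level N x t (\<rho> k t) (parent_ball N \<rho> x p t k) (S (t - 1) k) (S t k) (p t k)"
    using propagate assms by (auto simp: propagate_run_def)
  then show "S (t - 1) k \<subseteq> S t k" "S t k \<subseteq> insert t (S (t - 1) k)" "p t k \<in> S t k"
    by (auto simp: propagate_level_def Let_def is_arg_min_def split: if_splits)
  \<comment> \<open>A node created in round \<open>t\<close> is centered at \<open>x t\<close>
    itself, at distance 0; any other choice has passed the radius test.\<close>
  have "N 0 = 0" using norm by (simp add: is_norm_def)
  then show "N (x t - x (p t k)) \<le> \<rho> k t"
    using P radius_nonneg[of k t] by (auto simp: propagate_level_def Let_def split: if_splits)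
qed

lemma created_subset: "t \<le> T \<Longrightarrow> created t \<subseteq> {1..D} \<times> {1..t}"
  using propagate_run_centers(1)[OF propagate] by (fastforce simp: created_def)

lemma finite_created: "t \<le> T \<Longrightarrow> finite (created t)"
  using created_subset finite_subset by blast

lemma card_created_le: "card (created T) \<le> D * T"
  using card_mono[OF _ created_subset[OF order.refl]] by simp

lemma created_0: "created 0 = {}"
  using propagate by (auto simp: created_def propagate_run_def)

lemma created_mono:
  assumes "t \<le> t'" "t' \<le> T"
  shows "created t \<subseteq> created t'"
  using assms
proof (induction t' rule: dec_induct)
  case (step n)
  have "S n k \<subseteq> S (Suc n) k" if "k \<in> {1..D}" for k
    using propagate_step(1)[of "Suc n" k] step that by simp
  then have "created n \<subseteq> created (Suc n)" by (force simp: created_def)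
  then show ?case using step by auto
qed simp

lemma finite_active: "finite (active t)"
  by (simp add: active_nodes_def)

lemma active_nonempty: "active t \<noteq> {}"
  using levels by (auto simp: active_nodes_def)

lemma active_created: "t \<in> {1..T} \<Longrightarrow> active t \<subseteq> created t"
  using propagate_step(3) by (auto simp: active_nodes_def created_def)

lemma prediction_unit: "t \<in> {1..T} \<Longrightarrow> v \<in> active t \<Longrightarrow> g v t \<in> {0..1}"
  using ftl by (auto simp: ftl_run_def is_arg_min_def)

section \<open>Evolution of the Hedge weights\<close>

definition W :: "nat \<Rightarrow> real" where
  "W t = (\<Sum>v\<in>active t. w v (t - 1))"

definition Z :: "nat \<Rightarrow> real" where
  "Z t = (\<Sum>v\<in>active t. w v (t - 1) * exp (- (1/2) * sq_loss y t (g v t))) / W t"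

lemma hedge_step:
  assumes "t \<in> {1..T}"
  shows "v \<in> created t \<Longrightarrow> v \<notin> created (t - 1) \<Longrightarrow> w v (t - 1) = 1"
    and "yh t = (\<Sum>v\<in>active t. w v (t - 1) * g v t) / W t"
    and "v \<in> active t \<Longrightarrow> w v t = w v (t - 1) * exp (- (1/2) * sq_loss y t (g v t)) / Z t"
    and "v \<in> created t \<Longrightarrow> v \<notin> active t \<Longrightarrow> w v t = w v (t - 1)"
  using hedge assms unfolding hedge_run_def W_def Z_def created_def Let_def by fastforce+

lemma Z_pos:
  assumes "t \<in> {1..T}" "\<And>v. v \<in> active t \<Longrightarrow> w v (t - 1) > 0"
  shows "W t > 0" "Z t > 0"
proof -
  show "W t > 0" unfolding W_def
    using assms finite_active active_nonempty by (intro sum_pos) auto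
  then show "Z t > 0" unfolding Z_def
    using assms finite_active active_nonempty by (intro divide_pos_pos sum_pos) auto
qed

text \<open>Take logarithms in the weight update and bound \<open>ln (Z t)\<close> by exp-concavity.
  The factor 2 inverts the learning rate \<open>1/2\<close>.\<close>

lemma hedge_excess_loss:
  assumes "t \<in> {1..T}" "\<And>v. v \<in> active t \<Longrightarrow> w v (t - 1) > 0" "v \<in> active t"
  shows "sq_loss y t (yh t) - sq_loss y t (g v t) \<le> 2 * ln (w v t) - 2 * ln (w v (t - 1))"
proof -
  have "Z t \<le> exp (- (1/2) * sq_loss y t (yh t))"
    unfolding Z_def hedge_step(2)[OF assms(1)] W_def
    using assms prediction_unit y_unit
    by (intro weighted_exp_sq_loss_le[OF finite_active active_nonempty]) auto
  then have "ln (Z t) \<le> - (1/2) * sq_loss y t (yh t)"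
    using Z_pos[OF assms(1,2)] by (metis ln_exp ln_le_cancel_iff exp_gt_zero)
  moreover have "ln (w v t) = ln (w v (t - 1)) - (1/2) * sq_loss y t (g v t) - ln (Z t)"
    using hedge_step(3)[OF assms(1,3)] Z_pos(2)[OF assms(1,2)] assms(2)[OF assms(3)]
    by (simp add: ln_div ln_mult)
  ultimately show ?thesis by simp
qed

definition active_rounds :: "node \<Rightarrow> nat \<Rightarrow> nat set" where
  "active_rounds v t = {s\<in>{1..t}. v \<in> active s}"

lemma finite_active_rounds: "finite (active_rounds v t)"
  by (simp add: active_rounds_def)

text \<open>Both claims share one induction because the one-round loss bound needs positive weights
  at all active nodes. The regret part telescopes from \<open>ln 1 = 0\<close> at creation.\<close>

lemma weight_invariant:
  assumes "t \<le> T" "v \<in> created t"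
  shows "w v t > 0 \<and>
    (\<Sum>s\<in>active_rounds v t. sq_loss y s (yh s) - sq_loss y s (g v s)) \<le> 2 * ln (w v t)"
  using assms
proof (induction t arbitrary: v)
  case 0
  then show ?case by (simp add: created_0)
next
  case (Suc t)
  have t: "Suc t \<in> {1..T}" using Suc.prems by simp
  \<comment> \<open>A node created in the coming round has weight 1 and no active rounds yet, so
    both sides are 0.\<close>
  have before: "w v t > 0 \<and>
      (\<Sum>s\<in>active_rounds v t. sq_loss y s (yh s) - sq_loss y s (g v s)) \<le> 2 * ln (w v t)"
    if v: "v \<in> created (Suc t)" for v
  proof (cases "v \<in> created t")
    case True
    then show ?thesis using Suc by simp
  next
    case False
    have "v \<notin> active s" if "s \<in> {1..t}" for s
      using active_created[of s] created_mono[of s t] that Suc.prems False by auto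
    then have "active_rounds v t = {}" by (auto simp: active_rounds_def)
    moreover have "w v t = 1" using hedge_step(1)[OF t v] False by simp
    ultimately show ?thesis by simp
  qed
  have pos: "w u (Suc t - 1) > 0" if "u \<in> active (Suc t)" for u
    using before[of u] active_created[OF t] that by auto
  show ?case
  proof (cases "v \<in> active (Suc t)")
    case True
    have "active_rounds v (Suc t) = insert (Suc t) (active_rounds v t)"
      using True by (auto simp: active_rounds_def le_Suc_eq)
    moreover have "Suc t \<notin> active_rounds v t" by (simp add: active_rounds_def)
    moreover have "w v (Suc t) > 0"
      using hedge_step(3)[OF t True] pos[OF True] Z_pos(2)[OF t pos] by simp
    ultimately show ?thesis
      using hedge_excess_loss[OF t pos True] before[OF Suc.prems(2)]
      by (simp add: finite_active_rounds)
  next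
    case False
    then have "active_rounds v (Suc t) = active_rounds v t"
      by (auto simp: active_rounds_def le_Suc_eq)
    then show ?thesis using before Suc.prems(2) hedge_step(4)[OF t Suc.prems(2) False] by simp
  qed
qed

text \<open>The factor \<open>1 / Z\<close> makes each update preserve the total weight of the active nodes.\<close>

lemma total_weight: "t \<le> T \<Longrightarrow> (\<Sum>v\<in>created t. w v t) = real (card (created t))"
proof (induction t)
  case 0
  then show ?case by (simp add: created_0)
next
  case (Suc t)
  have t: "Suc t \<in> {1..T}" using Suc.prems by simp
  have fin: "finite (created (Suc t))" "finite (created t)" using Suc.prems finite_created by auto
  have sub: "created t \<subseteq> created (Suc t)" using created_mono[of t "Suc t"] Suc.prems by simp
  note ac = active_created[OF t]
  have pos: "w v (Suc t - 1) > 0" if "v \<in> active (Suc t)" for v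
    using weight_invariant[of t v] hedge_step(1)[OF t, of v] ac that Suc.prems
    by (cases "v \<in> created t") auto
  note Zp = Z_pos[OF t pos]
  have "(\<Sum>v\<in>active (Suc t). w v (Suc t))
      = (\<Sum>v\<in>active (Suc t). w v t * exp (- (1/2) * sq_loss y (Suc t) (g v (Suc t)))) / Z (Suc t)"
    unfolding sum_divide_distrib using hedge_step(3)[OF t] by (intro sum.cong) auto
  \<comment> \<open>\<open>Z\<close> is the updated, unnormalized weight sum divided by
    \<open>W\<close>.\<close>
  also have "\<dots> = Z (Suc t) * W (Suc t) / Z (Suc t)"
    using Zp by (simp add: Z_def)
  also have "\<dots> = (\<Sum>v\<in>active (Suc t). w v t)" using Zp by (simp add: W_def)
  finally have act: "(\<Sum>v\<in>active (Suc t). w v (Suc t)) = (\<Sum>v\<in>active (Suc t). w v t)" .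
  have "(\<Sum>v\<in>created (Suc t). w v (Suc t))
      = (\<Sum>v\<in>created (Suc t) - active (Suc t). w v (Suc t)) + (\<Sum>v\<in>active (Suc t). w v (Suc t))"
    using ac fin by (simp add: sum.subset_diff)
  also have "(\<Sum>v\<in>created (Suc t) - active (Suc t). w v (Suc t))
      = (\<Sum>v\<in>created (Suc t) - active (Suc t). w v t)"
    using hedge_step(4)[OF t] by (intro sum.cong) auto
  also have "\<dots> + (\<Sum>v\<in>active (Suc t). w v (Suc t)) = (\<Sum>v\<in>created (Suc t). w v t)"
    using ac fin act by (simp add: sum.subset_diff)
  \<comment> \<open>New nodes enter with weight 1, so the total keeps counting the nodes.\<close>
  also have "\<dots> = (\<Sum>v\<in>created (Suc t) - created t. w v t) + (\<Sum>v\<in>created t. w v t)"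
    using sub fin by (simp add: sum.subset_diff)
  also have "(\<Sum>v\<in>created (Suc t) - created t. w v t) = (\<Sum>v\<in>created (Suc t) - created t. 1)"
    using hedge_step(1)[OF t] by (intro sum.cong) auto
  also have "\<dots> + (\<Sum>v\<in>created t. w v t) = real (card (created (Suc t)))"
    using Suc fin sub by (simp add: card_Diff_subset card_mono)
  finally show ?case .
qed

lemma weight_le:
  assumes "v \<in> created T"
  shows "w v T \<le> real (D * T)"
proof -
  have "w v T \<le> (\<Sum>v\<in>created T. w v T)"
    using assms weight_invariant[of T] finite_created by (intro member_le_sum) (auto intro: less_imp_le)
  also have "\<dots> \<le> real (D * T)" 
    using total_weight[of T] card_created_le by (simp only: of_nat_le_iff order.refl)
  finally show ?thesis .
qed

lemma hedge_regret:
  assumes "v \<in> created T"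
  shows "(\<Sum>t\<in>active_rounds v T. sq_loss y t (yh t) - sq_loss y t (g v t)) \<le> 2 * ln (real (D * T))"
proof -
  have "w v T > 0" "w v T \<le> real (D * T)"
    using weight_invariant[of T v] weight_le assms by auto
  then have "ln (w v T) \<le> ln (real (D * T))" by simp
  then show ?thesis using weight_invariant[of T v] assms by simp
qed

text \<open>Passes from the forecaster to the local learner, then to the constant \<open>z\<close>,
  then to \<open>f\<close>; the three differences are bounded separately.\<close>

lemma node_regret:
  assumes "v \<in> created T" and f: "f \<in> lip_class N L" and L: "L \<ge> 0" and T: "T \<ge> 1"
  shows "(\<Sum>t\<in>active_rounds v T. sq_loss y t (yh t) - sq_loss y t (f (x t)))
    \<le> 2 * ln (real (D * T)) + 1 + ln (real T) + (\<Sum>t\<in>active_rounds v T. L * \<rho> (fst v) t)"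
proof -
  let ?B = "active_rounds v T"
  \<comment> \<open>The second component of a node is its creation round, so
    \<open>x (snd v)\<close> is its center.\<close>
  define z where "z = f (x (snd v))"
  have center: "x (snd v) \<in> unit_nball N"
    using created_subset[of T] assms(1) by (intro x_unit) auto
  have B: "t \<in> {1..T}" "v \<in> active t" if "t \<in> ?B" for t using that by (auto simp: active_rounds_def)
  have "(\<Sum>t\<in>?B. sq_loss y t (g v t)) \<le> (\<Sum>t\<in>?B. sq_loss y t z) + harm (card ?B)"
  proof (rule ftl_regret[OF finite_active_rounds])
    fix t assume t: "t \<in> ?B"
    show "y t \<in> {0..1}" using B[OF t] y_unit by simp
    have "{s \<in> {1..<t}. v \<in> active s} = ?B \<inter> {..<t}"
      using B(1)[OF t] by (auto simp: active_rounds_def)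
    moreover have "is_arg_min (\<lambda>z. \<Sum>s\<in>{s \<in> {1..<t}. v \<in> active s}. sq_loss y s z)
        (\<lambda>z. z \<in> {0..1}) (g v t)"
      using ftl B[OF t] unfolding ftl_run_def by blast
    ultimately show "is_arg_min (\<lambda>z. \<Sum>s\<in>?B \<inter> {..<t}. sq_loss y s z) (\<lambda>z. z \<in> {0..1}) (g v t)"
      by simp
  qed
  moreover have "(\<Sum>t\<in>?B. sq_loss y t z - sq_loss y t (f (x t))) \<le> (\<Sum>t\<in>?B. L * \<rho> (fst v) t)"
  proof (rule sum_mono)
    fix t assume t: "t \<in> ?B"
    have xt: "x t \<in> unit_nball N" using B[OF t] x_unit by simp
    obtain k where k: "k \<in> {1..D}" "v = (k, p t k)" using B(2)[OF t] by (auto simp: active_nodes_def)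
    have "z \<in> {0..1}" "f (x t) \<in> {0..1}" using f center xt by (auto simp: lip_class_def z_def)
    then have "sq_loss y t z - sq_loss y t (f (x t)) \<le> \<bar>z - f (x t)\<bar>"
      using B[OF t] y_unit by (intro sq_loss_diff_le) auto
    also have "\<dots> = \<bar>f (x t) - z\<bar>" by simp
    also have "\<dots> \<le> L * N (x t - x (snd v))"
      using f center xt by (auto simp: lip_class_def z_def)
    also have "\<dots> \<le> L * \<rho> (fst v) t"
      using propagate_step(4)[OF B(1)[OF t] k(1)] k L by (simp add: mult_left_mono)
    finally show "sq_loss y t z - sq_loss y t (f (x t)) \<le> L * \<rho> (fst v) t" .
  qed
  moreover have "harm (card ?B) \<le> 1 + ln (real T)"
  proof (cases "card ?B = 0")
    case True
    then show ?thesis using T by (simp add: harm_def)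
  next
    case False
    have "card ?B \<le> card {1..T}" by (intro card_mono) (auto simp: active_rounds_def)
    then have "ln (real (card ?B)) \<le> ln (real T)" using False by simp
    then show ?thesis using harm_le_one_plus_ln[of "card ?B"] False by simp
  qed
  ultimately show ?thesis using hedge_regret[OF assms(1)] by (simp add: sum_subtractf)
qed

section \<open>Summing over the leaves of a pruning\<close>

lemma finite_pruning:
  assumes "is_pruning (net_nodes D T S) R E"
  shows "finite E"
proof -
  have "E \<subseteq> net_nodes D T S" using assms by induction auto
  moreover have "net_nodes D T S = insert net_root (created T)"
    by (auto simp: net_nodes_def created_def)
  ultimately show ?thesis using finite_created[of T] finite_subset by auto
qed

text \<open>As every round has exactly one active leaf, the active rounds of the leaves partition all
  rounds.\<close>

lemma regret_le:
  assumes E: "is_pruning (net_nodes D T S) R E" and path: "unique_leaf_on_paths D T p R E"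
    and f: "f \<in> lip_class N L" and L: "L \<ge> 0" and T: "T \<ge> 1"
  shows "regret T (sq_loss y) yh x f
    \<le> real (num_leaves D R E) * (2 * ln (real (D * T)) + 1 + ln (real T))
      + (\<Sum>k\<in>{1..D}. \<Sum>t\<in>{t\<in>{1..T}. fst (leaf_of_round D p R E t) = k}. L * \<rho> k t)"
proof -
  let ?l = "leaf_of_round D p R E"
  \<comment> \<open>Only leaves associated with some round contribute; the count is enlarged to all
    leaves at the end, which requires \<open>?c \<ge> 0\<close>.\<close>
  let ?M = "?l ` {1..T}"
  let ?c = "2 * ln (real (D * T)) + 1 + ln (real T)"
  have leaf: "?l t \<in> leaves R E" "?l t \<in> active t" if "t \<in> {1..T}" for t
    using theI'[of "\<lambda>v. v \<in> leaves R E \<and> v \<in> active t"] path that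
    by (auto simp: unique_leaf_on_paths_def leaf_of_round_def)
  have uniq: "v = ?l t" if "t \<in> {1..T}" "v \<in> leaves R E" "v \<in> active t" for t v
    using path leaf that unfolding unique_leaf_on_paths_def by blast
  have rounds: "{t\<in>{1..T}. ?l t = v} = active_rounds v T" if "v \<in> ?M" for v
  proof -
    obtain s where s: "s \<in> {1..T}" "v = ?l s" using \<open>v \<in> ?M\<close> by (rule imageE)
    have "v \<in> leaves R E" unfolding s(2) by (rule leaf(1)[OF s(1)])
    then have "?l t = v \<longleftrightarrow> v \<in> active t" if "t \<in> {1..T}" for t
      using leaf(2)[OF that] uniq[OF that, of v] by metis
    then show ?thesis by (auto simp: active_rounds_def)
  qed
  have level: "fst (?l t) \<in> {1..D}" if "t \<in> {1..T}" for t
    using leaf(2)[OF that] by (auto simp: active_nodes_def)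
  note fin = finite_pruning[OF E]
  have "card ?M \<le> card (\<Union>k\<in>{1..D}. leaves_at R E k)"
    using fin leaf(1) level by (intro card_mono) (auto simp: leaves_at_def leaves_def)
  also have "\<dots> \<le> num_leaves D R E" unfolding num_leaves_def by (rule card_UN_le) simp
  finally have card: "card ?M \<le> num_leaves D R E" .
  have "D * T \<ge> 1" using T levels by simp
  then have "real (D * T) \<ge> 1" by (simp only: real_of_nat_ge_one_iff)
  then have c: "?c \<ge> 0" using T by (intro add_nonneg_nonneg mult_nonneg_nonneg ln_ge_zero) simp_all
  have "regret T (sq_loss y) yh x f
      = (\<Sum>v\<in>?M. \<Sum>t\<in>{t\<in>{1..T}. ?l t = v}. sq_loss y t (yh t) - sq_loss y t (f (x t)))"
    unfolding regret_def by (rule sum.image_gen) simp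
  also have "\<dots> \<le> (\<Sum>v\<in>?M. ?c + (\<Sum>t\<in>{t\<in>{1..T}. ?l t = v}. L * \<rho> (fst v) t))"
  proof (rule sum_mono)
    fix v assume v: "v \<in> ?M"
    then have "v \<in> created T"
      using leaf(2) active_created created_mono by fastforce
    then show "(\<Sum>t\<in>{t\<in>{1..T}. ?l t = v}. sq_loss y t (yh t) - sq_loss y t (f (x t)))
        \<le> ?c + (\<Sum>t\<in>{t\<in>{1..T}. ?l t = v}. L * \<rho> (fst v) t)"
      using node_regret[OF _ f L T] rounds[OF v] by simp
  qed
  \<comment> \<open>Within the block of \<open>v\<close> the leaf of the round is \<open>v\<close>,
    so the level can be read off the round. This allows the blocks to be merged and regrouped by
    level.\<close>
  also have "\<dots> = real (card ?M) * ?c + (\<Sum>v\<in>?M. \<Sum>t\<in>{t\<in>{1..T}. ?l t = v}. L * \<rho> (fst (?l t)) t)"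
    by (simp add: sum.distrib)
  also have "(\<Sum>v\<in>?M. \<Sum>t\<in>{t\<in>{1..T}. ?l t = v}. L * \<rho> (fst (?l t)) t) = (\<Sum>t\<in>{1..T}. L * \<rho> (fst (?l t)) t)"
    by (rule sum.image_gen[symmetric]) simp
  also have "\<dots> = (\<Sum>k\<in>{1..D}. \<Sum>t\<in>{t\<in>{1..T}. fst (?l t) = k}. L * \<rho> (fst (?l t)) t)"
    using level by (intro sum.group[symmetric]) auto
  also have "\<dots> = (\<Sum>k\<in>{1..D}. \<Sum>t\<in>{t\<in>{1..T}. fst (?l t) = k}. L * \<rho> k t)" by simp
  also have "real (card ?M) * ?c \<le> real (num_leaves D R E) * ?c"
    using card c by (intro mult_right_mono) auto
  finally show ?thesis by simp
qed

text \<open>Round 1 already has an active leaf. This makes the leaf fractions that define the law of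
  \<open>K\<close> sum to 1.\<close>

lemma num_leaves_pos:
  assumes E: "is_pruning (net_nodes D T S) R E" and path: "unique_leaf_on_paths D T p R E" and T: "T \<ge> 1"
  shows "num_leaves D R E > 0"
proof -
  obtain v where v: "v \<in> leaves R E" "v \<in> active 1"
    using path T unfolding unique_leaf_on_paths_def by fastforce
  have "finite (leaves_at R E (fst v))"
    using finite_pruning[OF E] by (simp add: leaves_at_def leaves_def)
  then have "card (leaves_at R E (fst v)) > 0" using v(1) by (metis (mono_tags, lifting) card_gt_0_iff empty_iff leaves_at_def mem_Collect_eq)
  moreover have "fst v \<in> {1..D}" using v(2) by (auto simp: active_nodes_def)
  ultimately show ?thesis unfolding num_leaves_def by (metis finite_atLeastAtMost gr0I sum_eq_0_iff)
qed

end

section \<open>Admissible prunings\<close>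

text \<open>With \<open>b = d k / (1 + d k)\<close> the radius is
  \<open>(L * t) powr (b - 1)\<close>, so each summand equals
  \<open>L powr b * t powr (b - 1)\<close>; the constant is \<open>1 / b\<close>.\<close>

lemma sum_radius_le:
  assumes L: "L > 0" and d: "d k > 0" and B: "finite B" "B \<subseteq> {1..}"
  shows "(\<Sum>t\<in>B. L * radius L d k t) \<le> (1 + d k) / d k * (L * real (card B)) powr (d k / (1 + d k))"
proof -
  define b where "b = d k / (1 + d k)"
  have b: "0 < b" "b < 1" "- (1 / (1 + d k)) = b - 1" using d by (auto simp: b_def field_simps)
  have "L * radius L d k t = L powr b * real t powr (b - 1)" for t
    using L by (simp add: radius_def b(3) powr_mult powr_diff)
  then have "(\<Sum>t\<in>B. L * radius L d k t) = L powr b * (\<Sum>t\<in>B. real t powr (b - 1))"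
    by (simp add: sum_distrib_left)
  also have "\<dots> \<le> L powr b * (real (card B) powr b / b)"
    using sum_powr_le_card_powr[OF b(1,2) B] by (intro mult_left_mono) auto
  also have "\<dots> = (1 + d k) / d k * (L * real (card B)) powr b"
    using L d by (simp add: b_def powr_mult)
  finally show ?thesis by (simp add: b_def)
qed

text \<open>Here admissibility enters: \<open>n k \<le> C * a k\<close> bounds the average of \<open>a\<close> below by the average of
  \<open>n / C\<close>, and Cauchy-Schwarz applies.\<close>

lemma sum_le_weighted_average:
  fixes n a :: "nat \<Rightarrow> real"
  assumes C: "C > 0" and n: "\<And>k. k \<in> {1..D} \<Longrightarrow> 0 \<le> n k" "\<And>k. k \<in> {1..D} \<Longrightarrow> n k \<le> C * a k"
    and pos: "(\<Sum>k\<in>{1..D}. n k) > 0"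
  shows "(\<Sum>k\<in>{1..D}. n k) \<le> C * real D * (\<Sum>k\<in>{1..D}. a k * (n k / (\<Sum>k\<in>{1..D}. n k)))"
proof -
  define s where "s = (\<Sum>k\<in>{1..D}. n k)"
  have "s\<^sup>2 \<le> real D * (\<Sum>k\<in>{1..D}. (n k)\<^sup>2)"
    using Cauchy_Schwarz_ineq_sum[of "\<lambda>_. 1" n "{1..D}"] by (simp add: s_def)
  also have "(\<Sum>k\<in>{1..D}. (n k)\<^sup>2) \<le> (\<Sum>k\<in>{1..D}. C * (a k * n k))"
    using n mult_right_mono[OF n(2) n(1)] by (intro sum_mono) (auto simp: power2_eq_square mult.assoc)
  finally have "s\<^sup>2 \<le> real D * (C * (\<Sum>k\<in>{1..D}. a k * n k))"
    by (simp add: sum_distrib_left mult_left_mono)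
  then have "s * s \<le> C * real D * (\<Sum>k\<in>{1..D}. a k * n k)"
    by (simp add: power2_eq_square mult_ac)
  moreover have "s > 0" using pos by (simp add: s_def)
  ultimately have "s \<le> C * real D * ((\<Sum>k\<in>{1..D}. a k * n k) / s)"
    by (simp add: pos_le_divide_eq)
  also have "(\<Sum>k\<in>{1..D}. a k * n k) / s = (\<Sum>k\<in>{1..D}. a k * (n k / s))"
    by (simp add: sum_divide_distrib)
  finally show ?thesis unfolding s_def .
qed

text \<open>Masses that sum to 1 on \<open>I\<close> leave none elsewhere, so prescribing
  \<open>K\<close> on the levels \<open>1..D\<close> determines the expectation.\<close>

lemma expectation_pmf_weights:
  fixes K :: "'k pmf" and h :: "'k \<Rightarrow> real"
  assumes "finite I" "(\<Sum>k\<in>I. pmf K k) = 1"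
  shows "measure_pmf.expectation K h = (\<Sum>k\<in>I. h k * pmf K k)"
proof (rule integral_measure_pmf_real[OF assms(1)])
  have "measure_pmf.prob K I = 1" using assms by (simp add: measure_measure_pmf_finite)
  then have "AE k in measure_pmf K. k \<in> I" by (subst measure_pmf.AE_in_set_eq_1) auto
  then show "k \<in> I" if "k \<in> set_pmf K" for k using that by (simp add: AE_measure_pmf_iff)
qed

section \<open>Combining aggregation and approximation errors\<close>

theorem theorem2:
  fixes N :: "real ^ 'n \<Rightarrow> real" and D :: nat and d :: "nat \<Rightarrow> real" and C :: real
  assumes "is_norm N"
    and "D \<ge> 1"
    and "d 1 = real CARD('n)"
    and "\<And>j k. 1 \<le> j \<Longrightarrow> j < k \<Longrightarrow> k \<le> D \<Longrightarrow> d k < d j"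
    and "d D > 0"
    and "metric_dim_const N (unit_nball N) (real CARD('n)) C"
  shows "\<exists>A>0. \<exists>q::nat. \<forall>L>0. \<exists>T\<^sub>0::nat. \<forall>T\<ge>T\<^sub>0.
    \<forall>(x :: nat \<Rightarrow> real ^ 'n) (y :: nat \<Rightarrow> real) S p w g yh.
      (\<forall>t\<in>{1..T}. x t \<in> unit_nball N \<and> y t \<in> {0..1}) \<and>
      propagate_run N D (radius L d) T x S p \<and>
      hedge_run D T (sq_loss y) S p w g yh \<and>
      ftl_run D T (sq_loss y) p g \<longrightarrow>
      (let V = net_nodes D T S; R = net_edges D T S p in
       \<forall>E \<in> dim_prunings D T L C d V R. unique_leaf_on_paths D T p R E \<longrightarrow>
         (\<forall>K :: nat pmf.
            (\<forall>k\<in>{1..D}. pmf K k = real (card (leaves_at R E k)) / real (num_leaves D R E)) \<longrightarrow>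
            (\<forall>f \<in> lip_class N L.
               regret T (sq_loss y) yh x f
               \<le> A * ln (real T) ^ q *
                  (measure_pmf.expectation K (\<lambda>k. (L * real T) powr (d k / (1 + d k)))
                   + (\<Sum>k\<in>{1..D}. (L * real (rounds_at D T p R E k)) powr (d k / (1 + d k)))))))"
proof -
  \<comment> \<open>\<open>C * D\<close> comes from Cauchy-Schwarz over the levels, and 6 from
    \<open>2 * ln (D * T) + 1 + ln T \<le> 6 * ln T\<close>. The sum \<open>a\<close> dominates the
    approximation constant of every level.\<close>
  define c where "c = 6 * C * real D"
  define a where "a = (\<Sum>k\<in>{1..D}. (1 + d k) / d k)"
  have C: "C > 0" using assms(6) by (simp add: metric_dim_const_def)
  have d: "d k > 0" if "k \<in> {1..D}" for k
    using that assms(4)[of k D] assms(5) by (cases "k = D") auto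
  have c: "c > 0" using C assms(2) by (simp add: c_def)
  have a: "a \<ge> 0" unfolding a_def using d by (intro sum_nonneg) (auto simp: less_imp_le)
  have a_ge: "(1 + d k) / d k \<le> a" if "k \<in> {1..D}" for k
    unfolding a_def using d that by (intro member_le_sum) (auto simp: less_imp_le)
  \<comment> \<open>\<open>T \<ge> 3\<close> gives \<open>ln T \<ge> 1\<close> because
    \<open>exp 1 \<le> 3\<close>, and \<open>T \<ge> D\<close> absorbs \<open>ln D\<close> into
    \<open>ln T\<close>.\<close>
  have bound: "regret T (sq_loss y) yh x f
       \<le> (c + a) * ln (real T) ^ 1 *
          (measure_pmf.expectation K (\<lambda>k. (L * real T) powr (d k / (1 + d k)))
           + (\<Sum>k\<in>{1..D}. (L * real (rounds_at D T p R E k)) powr (d k / (1 + d k))))"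
    if L: "L > 0" and T: "T \<ge> max 3 D"
      and xy: "\<forall>t\<in>{1..T}. x t \<in> unit_nball N \<and> y t \<in> {0..1}"
      and run: "propagate_run N D (radius L d) T x S p" "hedge_run D T (sq_loss y) S p w g yh"
        "ftl_run D T (sq_loss y) p g"
      and V: "V = net_nodes D T S"
      and E: "E \<in> dim_prunings D T L C d V R" and path: "unique_leaf_on_paths D T p R E"
      and K: "\<forall>k\<in>{1..D}. pmf K k = real (card (leaves_at R E k)) / real (num_leaves D R E)"
      and f: "f \<in> lip_class N L"
    for L T x y S p w g yh V R E K f
  proof -
    interpret algorithm_run N D T "radius L d" x y S p w g yh
      by unfold_locales (use assms(1,2) xy run in \<open>auto simp: radius_def\<close>)
    let ?a = "\<lambda>k. (L * real T) powr (d k / (1 + d k))"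
    let ?m = "\<lambda>k. (L * real (rounds_at D T p R E k)) powr (d k / (1 + d k))"
    let ?n = "\<lambda>k. real (card (leaves_at R E k))"
    have T1: "T \<ge> 1" using T by simp
    have E1: "is_pruning (net_nodes D T S) R E" and E2: "\<And>k. k \<in> {1..D} \<Longrightarrow> ?n k \<le> C * ?a k"
      using E V by (auto simp: dim_prunings_def)
    have leaf_sum: "(\<Sum>k\<in>{1..D}. ?n k) = real (num_leaves D R E)" by (simp add: num_leaves_def)
    have leaf_pos: "num_leaves D R E > 0" by (rule num_leaves_pos[OF E1 path T1])
    have "(\<Sum>k\<in>{1..D}. pmf K k) = (\<Sum>k\<in>{1..D}. ?n k) / real (num_leaves D R E)"
      using K by (simp add: sum_divide_distrib)
    also have "\<dots> = 1" using leaf_sum leaf_pos by simp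
    finally have "measure_pmf.expectation K ?a = (\<Sum>k\<in>{1..D}. ?a k * pmf K k)"
      by (intro expectation_pmf_weights) simp_all
    also have "\<dots> = (\<Sum>k\<in>{1..D}. ?a k * (?n k / (\<Sum>k\<in>{1..D}. ?n k)))"
      using K leaf_sum by simp
    finally have leaves_le: "real (num_leaves D R E) \<le> C * real D * measure_pmf.expectation K ?a"
      using sum_le_weighted_average[of C D ?n ?a] C E2 leaf_sum leaf_pos by simp
    have lnT: "ln (real T) \<ge> 1"
    proof -
      have "exp 1 \<le> real T" using T exp_le by linarith
      then show ?thesis using T1 by (subst ln_ge_iff) auto
    qed
    have "ln (real (D * T)) = ln (real D) + ln (real T)" using assms(2) T1 by (simp add: ln_mult)
    also have "ln (real D) \<le> ln (real T)" using T assms(2) by simp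
    finally have "2 * ln (real (D * T)) + 1 + ln (real T) \<le> 6 * ln (real T)" using lnT by simp
    then have "real (num_leaves D R E) * (2 * ln (real (D * T)) + 1 + ln (real T))
        \<le> real (num_leaves D R E) * (6 * ln (real T))"
      by (intro mult_left_mono) simp_all
    also have "\<dots> \<le> C * real D * measure_pmf.expectation K ?a * (6 * ln (real T))"
      using leaves_le lnT by (intro mult_right_mono) auto
    also have "\<dots> = c * ln (real T) * measure_pmf.expectation K ?a" by (simp add: c_def)
    finally have aggregation: "real (num_leaves D R E) * (2 * ln (real (D * T)) + 1 + ln (real T))
        \<le> c * ln (real T) * measure_pmf.expectation K ?a" .
    have "(\<Sum>k\<in>{1..D}. \<Sum>t\<in>{t\<in>{1..T}. fst (leaf_of_round D p R E t) = k}. L * radius L d k t)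
        \<le> (\<Sum>k\<in>{1..D}. a * ?m k)"
    proof (rule sum_mono)
      fix k assume k: "k \<in> {1..D}"
      have "(\<Sum>t\<in>{t\<in>{1..T}. fst (leaf_of_round D p R E t) = k}. L * radius L d k t)
          \<le> (1 + d k) / d k * ?m k"
        unfolding rounds_at_def using L d[OF k] by (intro sum_radius_le) auto
      also have "\<dots> \<le> a * ?m k" using a_ge[OF k] by (rule mult_right_mono) simp
      finally show "(\<Sum>t\<in>{t\<in>{1..T}. fst (leaf_of_round D p R E t) = k}. L * radius L d k t)
          \<le> a * ?m k" .
    qed
    also have "\<dots> = a * 1 * (\<Sum>k\<in>{1..D}. ?m k)" by (simp add: sum_distrib_left)
    also have "\<dots> \<le> a * ln (real T) * (\<Sum>k\<in>{1..D}. ?m k)"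
      using a lnT by (intro mult_right_mono mult_left_mono sum_nonneg) auto
    finally have approximation:
      "(\<Sum>k\<in>{1..D}. \<Sum>t\<in>{t\<in>{1..T}. fst (leaf_of_round D p R E t) = k}. L * radius L d k t)
        \<le> a * ln (real T) * (\<Sum>k\<in>{1..D}. ?m k)" .
    \<comment> \<open>These nonnegative cross terms are added so that the bound factors as
      \<open>c + a\<close> times the sum of both complexity terms.\<close>
    have "0 \<le> a * ln (real T) * measure_pmf.expectation K ?a"
      "0 \<le> c * ln (real T) * (\<Sum>k\<in>{1..D}. ?m k)"
      using a c lnT by (auto intro!: mult_nonneg_nonneg sum_nonneg integral_nonneg)
    then have "regret T (sq_loss y) yh x f
        \<le> c * ln (real T) * measure_pmf.expectation K ?a + c * ln (real T) * (\<Sum>k\<in>{1..D}. ?m k)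
          + (a * ln (real T) * measure_pmf.expectation K ?a + a * ln (real T) * (\<Sum>k\<in>{1..D}. ?m k))"
      using regret_le[OF E1 path f less_imp_le[OF L] T1] aggregation approximation by linarith
    then show ?thesis by (simp only: distrib_left distrib_right power_one_right)
  qed
  show ?thesis
    unfolding Let_def
  proof (rule exI[of _ "c + a"], rule conjI)
    show "c + a > 0" using a c by simp
  next
    show "\<exists>q. \<forall>L>0. \<exists>T\<^sub>0. \<forall>T\<ge>T\<^sub>0. \<forall>x y S p w g yh.
      (\<forall>t\<in>{1..T}. x t \<in> unit_nball N \<and> y t \<in> {0..1}) \<and>
      propagate_run N D (radius L d) T x S p \<and>
      hedge_run D T (sq_loss y) S p w g yh \<and>
      ftl_run D T (sq_loss y) p g \<longrightarrow>
      (\<forall>E \<in> dim_prunings D T L C d (net_nodes D T S) (net_edges D T S p).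
         unique_leaf_on_paths D T p (net_edges D T S p) E \<longrightarrow>
         (\<forall>K :: nat pmf.
            (\<forall>k\<in>{1..D}. pmf K k = real (card (leaves_at (net_edges D T S p) E k))
              / real (num_leaves D (net_edges D T S p) E)) \<longrightarrow>
            (\<forall>f \<in> lip_class N L.
               regret T (sq_loss y) yh x f
               \<le> (c + a) * ln (real T) ^ q *
                  (measure_pmf.expectation K (\<lambda>k. (L * real T) powr (d k / (1 + d k)))
                   + (\<Sum>k\<in>{1..D}. (L * real (rounds_at D T p (net_edges D T S p) E k))
                        powr (d k / (1 + d k)))))))"
    \<comment> \<open>A single logarithmic factor suffices, and the threshold \<open>max 3 D\<close>
      works for every \<open>L\<close>.\<close>
    proof (rule exI[of _ 1], intro allI impI, rule exI[of _ "max 3 D"], intro allI impI ballI, elim conjE, goal_cases)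
      case (1 L T x y S p w g yh E K f)
      show ?case by (rule bound[OF 1(1,2,7,8,9,10) refl 1(3,4,5,6)])
    qed
  qed
qed

end
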